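(* For every $d\in\{1,2,\ldots\}$, $C\geq1$ and $t>0$ there exist $\eta_0\in(0,d/C)$, $\delta_0>0$ and a constant $K\geq1$ (depending only on these parameters) such that the following holds for all $\delta\in2^{-\mathbb{N}}\cap(0,\delta_0]$. Let $\mathcal{P}\subset\mathcal{D}_\delta([0,1)^d)$ be a family with $|\mathcal{P}|=\delta^{-t}$. Then there exist a scale $\Delta\in2^{-\mathbb{N}}\cap[\delta,1]$, a number $\eta\in[\eta_0,d/C]$, a cube $Q\in\mathcal{D}_\Delta(\mathcal{P})$, and a subset $\mathcal{P}_Q\subset\mathcal{P}\cap Q$ with the following properties: (1) $|\mathcal{P}_Q|\geq\delta^\eta|\mathcal{P}|$, and (2) $S_Q(\mathcal{P}_Q)$ is a $(\delta/\Delta,\,C\eta,\,K)$-set. Here $S_Q$ is the affine homothety mapping $Q$ to $[0,1)^d$.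
   Context: For $\delta\in2^{-\mathbb{N}}$ (with $\mathbb{N}=\{0,1,2,\ldots\}$), $\mathcal{D}_\delta([0,1)^d)$ is the family of half-open dyadic cubes of side-length $\delta$ contained in $[0,1)^d$, and $|\mathcal{P}|$ is the cardinality of $\mathcal{P}$. For $\Delta\geq\delta$ dyadic, $\mathcal{D}_\Delta(\mathcal{P})$ is the family of dyadic cubes of side-length $\Delta$ intersecting $\bigcup\mathcal{P}$, and $\mathcal{P}\cap Q=\{p\in\mathcal{P}:p\subset Q\}$. $S_Q(\mathcal{P}_Q)=\{S_Q(p):p\in\mathcal{P}_Q\}$, a family of dyadic cubes of side-length $\delta/\Delta$ in $[0,1)^d$. $|\cdot|_\rho$ denotes the $\rho$-covering number of a subset of $\mathbb{R}^d$ in the Euclidean metric (least number of balls of radius $\rho$ needed to cover). $(\rho,s,K)$-set: for $\rho\in(0,1]$, $s\in[0,d]$, $K>0$, a nonempty bounded set $A\subset\mathbb{R}^d$ is a $(\rho,s,K)$-set if $|A\cap B(x,r)|_\rho\leq Kr^s|A|_\rho$ for all $x\in\mathbb{R}^d$ and $r\in[\rho,1]$. A family of dyadic cubes of side-length $\rho$ is a $(\rho,s,K)$-set if its union is. *)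

theory Defs
  imports "HOL-Analysis.Analysis"
begin

definition dyadic_scales :: "real set" where
  "dyadic_scales = {(1/2) ^ n | n :: nat. True}"

definition dyadic_cube :: "real \<Rightarrow> int ^ 'n \<Rightarrow> (real ^ 'n) set" where
  "dyadic_cube \<delta> k =
     {x. \<forall>i. of_int (k $ i) * \<delta> \<le> x $ i \<and> x $ i < (of_int (k $ i) + 1) * \<delta>}"

definition dyadic_cubes :: "real \<Rightarrow> (real ^ 'n) set set" where
  "dyadic_cubes \<delta> = range (dyadic_cube \<delta>)"

definition unit_cube :: "(real ^ 'n) set" where
  "unit_cube = {x. \<forall>i. 0 \<le> x $ i \<and> x $ i < 1}"

definition dyadic_cubes_in_unit :: "real \<Rightarrow> (real ^ 'n) set set" where
  "dyadic_cubes_in_unit \<delta> = {p \<in> dyadic_cubes \<delta>. p \<subseteq> unit_cube}"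

definition dyadic_cubes_meeting :: "real \<Rightarrow> (real ^ 'n) set set \<Rightarrow> (real ^ 'n) set set" where
  "dyadic_cubes_meeting \<Delta> P = {Q \<in> dyadic_cubes \<Delta>. Q \<inter> \<Union>P \<noteq> {}}"

definition cubes_within :: "(real ^ 'n) set set \<Rightarrow> (real ^ 'n) set \<Rightarrow> (real ^ 'n) set set" where
  "cubes_within P Q = {p \<in> P. p \<subseteq> Q}"

definition affine_homothety :: "(real ^ 'n \<Rightarrow> real ^ 'n) \<Rightarrow> bool" where
  "affine_homothety f \<longleftrightarrow> (\<exists>c b. c \<noteq> 0 \<and> f = (\<lambda>x. c *\<^sub>R x + b))"

(* Meaningful for half-open cubes Q only, where such a map exists and is unique (a negative ratio
   would turn the half-open sides around); see rescale_dyadic_cube for the explicit formula. *)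
definition rescale :: "(real ^ 'n) set \<Rightarrow> real ^ 'n \<Rightarrow> real ^ 'n" where
  "rescale Q = (THE f. affine_homothety f \<and> f ` Q = unit_cube)"

(* Closed balls with arbitrary centres; meaningful for bounded A and \<rho> > 0, where the set of
   admissible n is nonempty. *)
definition covering_number :: "real \<Rightarrow> (real ^ 'n) set \<Rightarrow> nat" where
  "covering_number \<rho> A = (LEAST n. \<exists>X. finite X \<and> card X = n \<and> A \<subseteq> (\<Union>x\<in>X. cball x \<rho>))"

definition delta_s_set :: "real \<Rightarrow> real \<Rightarrow> real \<Rightarrow> (real ^ 'n) set \<Rightarrow> bool" where
  "delta_s_set \<rho> s K A \<longleftrightarrow>
     0 < \<rho> \<and> \<rho> \<le> 1 \<and> 0 \<le> s \<and> s \<le> real CARD('n) \<and> 0 < K \<and> A \<noteq> {} \<and> bounded A \<and>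
     (\<forall>x r. \<rho> \<le> r \<and> r \<le> 1 \<longrightarrow>
        real (covering_number \<rho> (A \<inter> cball x r)) \<le> K * r powr s * real (covering_number \<rho> A))"

definition delta_s_family :: "real \<Rightarrow> real \<Rightarrow> real \<Rightarrow> (real ^ 'n) set set \<Rightarrow> bool" where
  "delta_s_family \<rho> s K P \<longleftrightarrow> P \<subseteq> dyadic_cubes \<rho> \<and> delta_s_set \<rho> s K (\<Union>P)"

lemma rescale_dyadic_cube:
  fixes k :: "int ^ 'n"
  assumes "\<delta> > 0"
  shows "rescale (dyadic_cube \<delta> k) = (\<lambda>x. (1 / \<delta>) *\<^sub>R (x - (\<chi> i. of_int (k $ i) * \<delta>)))"
proof -
  define a :: "real ^ 'n" where "a = (\<chi> i. of_int (k $ i) * \<delta>)"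
  have Q: "x \<in> dyadic_cube \<delta> k \<longleftrightarrow> (\<forall>i. a $ i \<le> x $ i \<and> x $ i < a $ i + \<delta>)" for x
    by (simp add: dyadic_cube_def a_def distrib_right)
  define g :: "real ^ 'n \<Rightarrow> real ^ 'n" where "g = (\<lambda>x. (1 / \<delta>) *\<^sub>R (x - a))"
  have hom: "affine_homothety g"
    unfolding affine_homothety_def g_def using assms
    by (intro exI[of _ "1/\<delta>"] exI[of _ "- (1/\<delta>) *\<^sub>R a"]) (auto simp: algebra_simps)
  have img: "g ` dyadic_cube \<delta> k = unit_cube"
  proof (intro subset_antisym subsetI)
    fix y assume "y \<in> g ` dyadic_cube \<delta> k"
    then show "y \<in> unit_cube"
      using assms by (auto simp: Q g_def unit_cube_def field_simps)
  next
    fix y :: "real ^ 'n" assume "y \<in> unit_cube"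
    then have "a + \<delta> *\<^sub>R y \<in> dyadic_cube \<delta> k" "g (a + \<delta> *\<^sub>R y) = y"
      using assms by (auto simp: Q g_def unit_cube_def)
    then show "y \<in> g ` dyadic_cube \<delta> k" by (metis imageI)
  qed
  have uniq: "f = g" if f: "affine_homothety f" "f ` dyadic_cube \<delta> k = unit_cube" for f
  proof -
    obtain c b where c: "c \<noteq> 0" "f = (\<lambda>x. c *\<^sub>R x + b)"
      using f(1) by (auto simp: affine_homothety_def)
    have fx: "f x $ i = c * (x $ i - a $ i) + f a $ i" for x i
      by (simp add: c(2) algebra_simps)
    have line: "0 \<le> c * t + f a $ i \<and> c * t + f a $ i < 1" if "0 \<le> t" "t < \<delta>" for t i
    proof -
      have "a + (\<chi> i. t) \<in> dyadic_cube \<delta> k" using that by (simp add: Q)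
      then have "f (a + (\<chi> i. t)) \<in> unit_cube" using f(2) by blast
      then have "0 \<le> f (a + (\<chi> i. t)) $ i \<and> f (a + (\<chi> i. t)) $ i < 1" by (simp add: unit_cube_def)
      then show ?thesis unfolding fx[of "a + (\<chi> i. t)" i] by simp
    qed
    have onto: "\<exists>t. 0 \<le> t \<and> t < \<delta> \<and> c * t + f a $ i = s" if "0 \<le> s" "s < 1" for s i
    proof -
      have "(\<chi> i. s) \<in> (unit_cube :: (real ^ 'n) set)" using that by (simp add: unit_cube_def)
      then obtain x where x: "x \<in> dyadic_cube \<delta> k" "f x = (\<chi> i. s)"
        using f(2) by (metis imageE)
      show ?thesis
        using x(1) fx[of x i] unfolding Q x(2) by (intro exI[of _ "x $ i - a $ i"]) (auto simp: algebra_simps)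
    qed
    have pos: "c > 0"
    proof (rule ccontr)
      assume "\<not> c > 0"
      with c have neg: "c < 0" by simp
      fix i :: 'n
      obtain t where t: "0 \<le> t" "t < \<delta>" "c * t + f a $ i = 0" using onto[of 0 i] by auto
      obtain u where u: "t < u" "u < \<delta>" using dense t(2) by blast
      have "c * u < c * t" using neg u by simp
      with line[of u i] t u show False by auto
    qed
    have fa: "f a $ i = 0" for i
    proof -
      obtain t where t: "0 \<le> t" "t < \<delta>" "c * t + f a $ i = 0" using onto[of 0 i] by auto
      moreover have "c * t \<ge> 0" using pos t by simp
      ultimately show ?thesis using line[of 0 i] assms by simp
    qed
    have "c * \<delta> = 1"
    proof (rule antisym)
      show "c * \<delta> \<le> 1"
      proof (rule ccontr)
        assume "\<not> c * \<delta> \<le> 1"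
        then have "1 / c < \<delta>" using pos by (simp add: field_simps)
        then show False using line[of "1/c"] fa pos by simp
      qed
      show "1 \<le> c * \<delta>"
      proof (rule ccontr)
        assume "\<not> 1 \<le> c * \<delta>"
        moreover have "0 \<le> c * \<delta>" using pos assms by simp
        ultimately obtain t where "t < \<delta>" "c * t = c * \<delta>" using onto[of "c * \<delta>"] fa by auto
        then show False using pos by simp
      qed
    qed
    then have "c = 1 / \<delta>" using assms by (simp add: field_simps)
    then have "f x $ i = g x $ i" for x i
      using fx[of x i] fa[of i] by (simp add: g_def)
    then show ?thesis by (simp add: fun_eq_iff vec_eq_iff)
  qed
  show ?thesis
    unfolding rescale_def a_def[symmetric] g_def[symmetric]
    using hom img uniq by (intro the_equality) blast+
qed

end

theory Submission
  imports Defs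
begin

text \<open>
  Take \<open>\<delta> = 2\<^sup>-\<^sup>n\<close>, let \<open>M k\<close> be the largest number of elements of \<open>P\<close> inside a single dyadic cube of
  side \<open>2\<^sup>-\<^sup>k\<close>, and put \<open>a k = log 2 (M 0 / M k)\<close>, so \<open>a 0 = 0\<close> and \<open>a n = t n\<close>. If \<open>Q\<close> realises
  \<open>M k\<close>, then \<open>P \<inter> Q\<close> rescales to an \<open>s\<close>-dimensional set as soon as \<open>a j \<ge> a k + s (j - k)\<close> for all
  \<open>j \<ge> k\<close>, and it is large enough when \<open>a k \<le> n s / C\<close>. If no \<open>k\<close> worked with \<open>s = C a k / n\<close>, then
  \<open>a\<close> would grow at most like \<open>exp (C k / n)\<close>, which is incompatible with \<open>a 0 = 0\<close> and \<open>a n = t n\<close>.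
  Truncating \<open>a\<close> from below at a small multiple of \<open>n\<close> makes this quantitative.
\<close>

section \<open>Growth of real sequences\<close>

text \<open>Choose \<open>k\<close> to minimise \<open>b k * exp (- (C * k / n))\<close>, where
  \<open>b\<close> is \<open>a\<close> truncated from below. Minimality gives
  \<open>b j >= b k * exp (C * (j - k) / n)\<close>, and \<open>1 + x <= exp x\<close> turns this
  into linear growth from \<open>k\<close> on with slope \<open>s = C * b k / n\<close>.\<close>

lemma exists_supporting_index:
  fixes a :: "nat \<Rightarrow> real" and C t s0 :: real
  assumes n: "n > 0" and C: "C > 0" and s0: "s0 > 0" "s0 * exp C < C * t"
    and a0: "a 0 = 0" and an: "a n \<ge> t * n"
  shows "\<exists>k<n. \<exists>s. s \<ge> s0 \<and> a k \<le> n * s / C \<and> (\<forall>j. k \<le> j \<and> j \<le> n \<longrightarrow> a j \<ge> a k + s * (real j - real k))"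
proof -
  \<comment> \<open>The floor \<open>n * s0 / C\<close> keeps \<open>b\<close> positive although
    \<open>a 0 = 0\<close>, and is exactly what forces \<open>s >= s0\<close>.\<close>
  define b where "b k = max (a k) (n * s0 / C)" for k
  define g where "g k = b k * exp (- (C * k / n))" for k
  have b_pos: "b k > 0" for k
    using n C s0 by (simp add: b_def less_max_iff_disj)
  obtain k where k: "k \<le> n" "\<And>j. j \<le> n \<Longrightarrow> g k \<le> g j"
    using arg_min_if_finite[of "{..n}" g] by (force simp: not_less)
  define s where "s = C * b k / n"
  have s: "s \<ge> s0"
    using n C by (simp add: s_def b_def field_simps max_def)
  \<comment> \<open>The hypothesis \<open>s0 * exp C < C * t\<close> says precisely that the floor,
    which is the value of \<open>g\<close> at 0, lies below \<open>t * n * exp (- C)\<close>, hence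
    below \<open>g n\<close>.\<close>
  have "k \<noteq> n"
  proof
    assume "k = n"
    have "b 0 = n * s0 / C"
      using a0 n C s0 by (simp add: b_def max_def)
    then have "g 0 = n * s0 / C"
      by (simp add: g_def)
    also have "\<dots> < t * n * exp (- C)"
      using n C s0 by (simp add: field_simps exp_minus)
    also have "\<dots> \<le> g n"
      using an n by (simp add: g_def b_def)
    finally show False
      using k(2)[of 0] \<open>k = n\<close> by simp
  qed
  moreover have "a j \<ge> a k + s * (real j - real k)" if j: "k \<le> j" "j \<le> n" for j
  proof (cases "j = k")
    case False
    with j have "k < j" by simp
    have "b k + s * (real j - real k) = b k * (1 + C * (real j - real k) / n)"
      using n by (simp add: s_def field_simps)
    also have "\<dots> \<le> b k * exp (C * (real j - real k) / n)"
      using b_pos[of k] exp_ge_add_one_self[of "C * (real j - real k) / n"] by simp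
    also have "\<dots> = g k * exp (C * j / n)"
      by (simp add: g_def exp_add[symmetric] diff_divide_distrib right_diff_distrib)
    also have "\<dots> \<le> g j * exp (C * j / n)"
      using k(2)[OF j(2)] by simp
    also have "\<dots> = b j"
      by (simp add: g_def exp_minus)
    finally have le: "b k + s * (real j - real k) \<le> b j" .
    \<comment> \<open>Strict growth lifts \<open>b j\<close> above the floor, so the truncation is
      inactive at \<open>j\<close>. At \<open>k\<close> only \<open>a k <= b k\<close> is needed,
      and it holds in either case.\<close>
    have "s * (real j - real k) > 0"
      using s s0 \<open>k < j\<close> by simp
    then have "b j > n * s0 / C"
      using le by (simp add: b_def)
    then have "b j = a j"
      by (simp add: b_def max_def split: if_splits)
    then show ?thesis
      using le by (simp add: b_def)
  qed simp
  moreover have "a k \<le> n * s / C"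
    using n C by (simp add: s_def b_def)
  ultimately show ?thesis
    using k(1) s by (intro exI[of _ k] conjI exI[of _ s]) auto
qed

subsection \<open>Dyadic cubes\<close>

lemma mem_dyadic_cube_iff_floor:
  assumes "\<delta> > 0"
  shows "x \<in> dyadic_cube \<delta> k \<longleftrightarrow> (\<forall>i. \<lfloor>x $ i / \<delta>\<rfloor> = k $ i)"
  using assms by (simp add: dyadic_cube_def floor_eq_iff field_simps)

lemma dyadic_cube_nonempty:
  assumes "\<delta> > 0"
  shows "dyadic_cube \<delta> k \<noteq> {}"
proof -
  have "(\<chi> i. of_int (k $ i) * \<delta>) \<in> dyadic_cube \<delta> k"
    using assms by (simp add: mem_dyadic_cube_iff_floor)
  then show ?thesis by blast
qed

lemma dyadic_cubes_nonempty:
  assumes "Q \<in> dyadic_cubes \<delta>" "\<delta> > 0"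
  shows "Q \<noteq> {}"
  using assms by (auto simp: dyadic_cubes_def dyadic_cube_nonempty)

text \<open>The floor of \<open>y / (1/2)^l\<close> is the floor of \<open>y / (1/2)^n\<close>
  divided (rounding down) by \<open>2 ^ (n - l)\<close>. So the coarse cube containing a point
  depends only on the index of its fine cube: a fine cube lies inside a coarse one as soon as they
  share a point.\<close>

lemma dyadic_cube_subset_iff:
  assumes "l \<le> n" and x: "x \<in> dyadic_cube ((1/2)^n) p"
  shows "dyadic_cube ((1/2)^n) p \<subseteq> dyadic_cube ((1/2)^l) q \<longleftrightarrow> x \<in> dyadic_cube ((1/2)^l) q"
    and "x \<in> dyadic_cube ((1/2)^l) q \<longleftrightarrow> (\<forall>i. p $ i div 2 ^ (n - l) = q $ i)"
proof -
  have fl: "\<lfloor>y / (1/2)^l\<rfloor> = \<lfloor>y / (1/2)^n\<rfloor> div 2 ^ (n - l)" for y :: real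
  proof -
    have "y / (1/2)^l = (y / (1/2)^n) / real_of_int (2 ^ (n - l))"
      using power_add[of "2::real" l "n - l"] assms(1) by (simp add: field_simps power_one_over)
    then show ?thesis
      using floor_divide_real_eq_div[of "2 ^ (n - l)" "y / (1/2)^n"] by (simp del: divide_divide_eq_left)
  qed
  have *: "y \<in> dyadic_cube ((1/2)^l) q \<longleftrightarrow> (\<forall>i. p $ i div 2 ^ (n - l) = q $ i)"
    if "y \<in> dyadic_cube ((1/2)^n) p" for y
    using that by (simp add: mem_dyadic_cube_iff_floor fl)
  show "x \<in> dyadic_cube ((1/2)^l) q \<longleftrightarrow> (\<forall>i. p $ i div 2 ^ (n - l) = q $ i)"
    using * x by blast
  show "dyadic_cube ((1/2)^n) p \<subseteq> dyadic_cube ((1/2)^l) q \<longleftrightarrow> x \<in> dyadic_cube ((1/2)^l) q"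
    using * x by blast
qed

section \<open>Counting cubes through their integer indices\<close>

lemma
  fixes S :: "'n::finite \<Rightarrow> 'a set"
  assumes "\<And>i. finite (S i)"
  shows finite_vec_box: "finite {q :: 'a ^ 'n. \<forall>i. q $ i \<in> S i}"
    and card_vec_box_le: "card {q :: 'a ^ 'n. \<forall>i. q $ i \<in> S i} \<le> (\<Prod>i\<in>UNIV. card (S i))"
proof -
  have sub: "{q :: 'a ^ 'n. \<forall>i. q $ i \<in> S i} \<subseteq> vec_lambda ` PiE UNIV S"
  proof
    fix q :: "'a ^ 'n" assume "q \<in> {q. \<forall>i. q $ i \<in> S i}"
    then show "q \<in> vec_lambda ` PiE UNIV S"
      by (intro image_eqI[of _ _ "vec_nth q"]) auto
  qed
  have fin: "finite (PiE UNIV S)"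
    using assms by (intro finite_PiE) auto
  show "finite {q :: 'a ^ 'n. \<forall>i. q $ i \<in> S i}"
    using sub fin finite_subset by blast
  have "card {q :: 'a ^ 'n. \<forall>i. q $ i \<in> S i} \<le> card (PiE UNIV S)"
    by (rule surj_card_le[OF fin sub])
  then show "card {q :: 'a ^ 'n. \<forall>i. q $ i \<in> S i} \<le> (\<Prod>i\<in>UNIV. card (S i))"
    by (simp add: card_PiE)
qed

text \<open>Points at distance at most \<open>\<rho>\<close> have coordinates whose floors after
  division by \<open>\<rho>\<close> differ by at most one, which leaves three choices per
  coordinate.\<close>

lemma
  fixes x :: "real ^ 'n"
  assumes r: "r \<le> \<rho>" and \<rho>: "\<rho> > 0"
  shows finite_dyadic_cubes_meeting_cball: "finite {Q \<in> dyadic_cubes \<rho>. Q \<inter> cball x r \<noteq> {}}"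
    and card_dyadic_cubes_meeting_cball:
      "card {Q \<in> dyadic_cubes \<rho>. Q \<inter> cball x r \<noteq> {}} \<le> 3 ^ CARD('n)"
proof -
  define S where "S i = {\<lfloor>x $ i / \<rho>\<rfloor> - 1..\<lfloor>x $ i / \<rho>\<rfloor> + 1}" for i
  let ?B = "{q :: int ^ 'n. \<forall>i. q $ i \<in> S i}"
  have sub: "{Q \<in> dyadic_cubes \<rho>. Q \<inter> cball x r \<noteq> {}} \<subseteq> dyadic_cube \<rho> ` ?B"
  proof
    fix Q assume "Q \<in> {Q \<in> dyadic_cubes \<rho>. Q \<inter> cball x r \<noteq> {}}"
    then obtain q y where "Q = dyadic_cube \<rho> q" "y \<in> Q" "y \<in> cball x r"
      unfolding dyadic_cubes_def by blast
    then have q: "Q = dyadic_cube \<rho> q" "y \<in> dyadic_cube \<rho> q" "dist x y \<le> r"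
      by simp_all
    have "q $ i \<in> S i" for i
    proof -
      have "\<bar>x $ i - y $ i\<bar> \<le> \<rho>"
        using q(3) r component_le_norm_cart[of "x - y" i] by (simp add: dist_norm)
      then have "\<bar>x $ i / \<rho> - y $ i / \<rho>\<bar> \<le> 1"
        using \<rho> by (simp add: abs_divide flip: diff_divide_distrib)
      then have "\<lfloor>x $ i / \<rho>\<rfloor> - 1 \<le> \<lfloor>y $ i / \<rho>\<rfloor>" "\<lfloor>y $ i / \<rho>\<rfloor> \<le> \<lfloor>x $ i / \<rho>\<rfloor> + 1"
        by linarith+
      then show ?thesis
        using q(2) \<rho> by (simp add: S_def mem_dyadic_cube_iff_floor)
    qed
    then show "Q \<in> dyadic_cube \<rho> ` ?B"
      using q(1) by blast
  qed
  have fin: "finite ?B"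
    by (rule finite_vec_box) (simp add: S_def)
  show "finite {Q \<in> dyadic_cubes \<rho>. Q \<inter> cball x r \<noteq> {}}"
    using sub fin by (meson finite_imageI finite_subset)
  have "card {Q \<in> dyadic_cubes \<rho>. Q \<inter> cball x r \<noteq> {}} \<le> card ?B"
    by (rule surj_card_le[OF fin sub])
  also have "\<dots> \<le> (\<Prod>i\<in>UNIV. card (S i))"
    by (rule card_vec_box_le) (simp add: S_def)
  also have "\<dots> = 3 ^ CARD('n)"
    by (simp add: S_def)
  finally show "card {Q \<in> dyadic_cubes \<rho>. Q \<inter> cball x r \<noteq> {}} \<le> 3 ^ CARD('n)" .
qed

text \<open>Integers with a prescribed quotient on division by \<open>2 ^ (n - l)\<close> form an
  interval of that length, in each coordinate.\<close>

lemma card_cubes_within_le: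
  fixes P :: "(real ^ 'n) set set"
  assumes P: "P \<subseteq> dyadic_cubes ((1/2)^n)" and Q: "Q \<in> dyadic_cubes ((1/2)^l)" and l: "l \<le> n"
  shows "card (cubes_within P Q) \<le> (2 ^ (n - l)) ^ CARD('n)"
proof -
  obtain q where q: "Q = dyadic_cube ((1/2)^l) q"
    using Q by (auto simp: dyadic_cubes_def)
  define N :: int where "N = 2 ^ (n - l)"
  have N: "N > 0"
    by (simp add: N_def)
  define S where "S i = {q $ i * N..<q $ i * N + N}" for i
  let ?B = "{p :: int ^ 'n. \<forall>i. p $ i \<in> S i}"
  have sub: "cubes_within P Q \<subseteq> dyadic_cube ((1/2)^n) ` ?B"
  proof
    fix p assume "p \<in> cubes_within P Q"
    then obtain k where k: "p = dyadic_cube ((1/2)^n) k" "p \<subseteq> Q"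
      using P by (auto simp: cubes_within_def dyadic_cubes_def)
    obtain x where x: "x \<in> p"
      using dyadic_cube_nonempty[of "(1/2)^n" k] k(1) by auto
    have kq: "k $ i div N = q $ i" for i
      using dyadic_cube_subset_iff(2)[OF l, of x k q] x k q by (auto simp: N_def)
    have "k $ i \<in> S i" for i
      using div_mult_mod_eq[of "k $ i" N] pos_mod_bound[OF N, of "k $ i"]
        pos_mod_sign[OF N, of "k $ i"] by (simp add: S_def kq)
    then show "p \<in> dyadic_cube ((1/2)^n) ` ?B"
      using k(1) by blast
  qed
  have fin: "finite ?B"
    by (rule finite_vec_box) (simp add: S_def)
  have "card (cubes_within P Q) \<le> card ?B"
    by (rule surj_card_le[OF fin sub])
  also have "\<dots> \<le> (\<Prod>i\<in>UNIV. card (S i))"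
    by (rule card_vec_box_le) (simp add: S_def)
  also have "\<dots> = (2 ^ (n - l)) ^ CARD('n)"
    by (simp add: S_def N_def nat_power_eq)
  finally show ?thesis .
qed

section \<open>Action of the rescaling on dyadic cubes\<close>

text \<open>Measured in units of the small side, the homothety subtracts the integer
  \<open>2^l * k $ i\<close> from each coordinate, and this commutes with taking floors. The small
  cube may lie outside the cube being rescaled.\<close>

lemma rescale_image_dyadic_cube:
  assumes "\<Delta> > 0"
  shows "rescale (dyadic_cube \<Delta> k) ` dyadic_cube (\<Delta> * (1/2)^l) j
           = dyadic_cube ((1/2)^l) (\<chi> i. j $ i - 2^l * k $ i)"
proof -
  let ?f = "\<lambda>x. (1 / \<Delta>) *\<^sub>R (x - (\<chi> i. of_int (k $ i) * \<Delta>))"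
  have mem: "?f x \<in> dyadic_cube ((1/2)^l) (\<chi> i. j $ i - 2^l * k $ i)
      \<longleftrightarrow> x \<in> dyadic_cube (\<Delta> * (1/2)^l) j" for x
  proof -
    have "?f x $ i / (1/2)^l = x $ i / (\<Delta> * (1/2)^l) - real_of_int (2^l * k $ i)" for i
      using assms by (simp add: field_simps power_one_over)
    then have "\<lfloor>?f x $ i / (1/2)^l\<rfloor> = \<lfloor>x $ i / (\<Delta> * (1/2)^l)\<rfloor> - 2^l * k $ i" for i
      by (metis floor_diff_of_int)
    then show ?thesis
      using assms by (simp add: mem_dyadic_cube_iff_floor)
  qed
  have inv: "?f (\<Delta> *\<^sub>R y + (\<chi> i. of_int (k $ i) * \<Delta>)) = y" for y
    using assms by simp
  show ?thesis
    unfolding rescale_dyadic_cube[OF assms]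
  proof (intro subset_antisym subsetI)
    fix y assume "y \<in> ?f ` dyadic_cube (\<Delta> * (1/2)^l) j"
    then show "y \<in> dyadic_cube ((1/2)^l) (\<chi> i. j $ i - 2^l * k $ i)"
      using mem by blast
  next
    fix y assume "y \<in> dyadic_cube ((1/2)^l) (\<chi> i. j $ i - 2^l * k $ i)"
    then have "\<Delta> *\<^sub>R y + (\<chi> i. of_int (k $ i) * \<Delta>) \<in> dyadic_cube (\<Delta> * (1/2)^l) j"
      unfolding mem[symmetric] inv .
    then show "y \<in> ?f ` dyadic_cube (\<Delta> * (1/2)^l) j"
      by (rule image_eqI[rotated]) (rule inv[symmetric])
  qed
qed

lemma inj_rescale_dyadic_cube:
  assumes "\<Delta> > 0"
  shows "inj (rescale (dyadic_cube \<Delta> k))"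
  using assms by (auto simp: rescale_dyadic_cube inj_on_def)

subsection \<open>Covering numbers of unions of dyadic cubes\<close>

lemma covering_number_le:
  assumes "finite X" "A \<subseteq> (\<Union>x\<in>X. cball x \<rho>)"
  shows "covering_number \<rho> A \<le> card X"
  unfolding covering_number_def using assms by (intro Least_le) auto

text \<open>Total boundedness supplies some finite cover, so the \<open>LEAST\<close> defining the
  covering number is genuinely attained.\<close>

lemma covering_number_attained:
  assumes "bounded A" "\<rho> > 0"
  obtains X where "finite X" "card X = covering_number \<rho> A" "A \<subseteq> (\<Union>x\<in>X. cball x \<rho>)"
proof -
  have "compact (closure A)"
    using assms(1) by simp
  then obtain X where X: "finite X" "closure A \<subseteq> (\<Union>x\<in>X. ball x \<rho>)"
    using assms(2) unfolding compact_eq_totally_bounded by blast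
  then have "A \<subseteq> (\<Union>x\<in>X. cball x \<rho>)"
    using closure_subset[of A] ball_subset_cball by blast
  with X(1) have "\<exists>n X. finite X \<and> card X = n \<and> A \<subseteq> (\<Union>x\<in>X. cball x \<rho>)"
    by blast
  from LeastI_ex[OF this] show thesis
    unfolding covering_number_def[symmetric] using that by blast
qed

text \<open>One finite cover of the closed unit cube by unit balls is translated and scaled to every
  dyadic cube, so \<open>c\<close> depends on the dimension alone. The bound
  \<open>Suc (card X)\<close> is used to make \<open>c\<close> visibly positive.\<close>

lemma dyadic_cube_cover:
  obtains c :: nat where "c > 0"
    "\<And>\<rho> (q :: int ^ 'n). \<rho> > 0 \<Longrightarrow>
      \<exists>X. finite X \<and> card X \<le> c \<and> dyadic_cube \<rho> q \<subseteq> (\<Union>x\<in>X. cball x \<rho>)"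
proof -
  obtain X :: "(real ^ 'n) set" where X: "finite X" "cbox 0 1 \<subseteq> (\<Union>x\<in>X. ball x 1)"
    using compact_cbox[of "0 :: real ^ 'n" 1] unfolding compact_eq_totally_bounded
    by (meson zero_less_one)
  have "\<exists>Y. finite Y \<and> card Y \<le> Suc (card X) \<and> dyadic_cube \<rho> q \<subseteq> (\<Union>x\<in>Y. cball x \<rho>)"
    if \<rho>: "\<rho> > 0" for \<rho> and q :: "int ^ 'n"
  proof (intro exI conjI)
    define v :: "real ^ 'n" where "v = (\<chi> i. of_int (q $ i))"
    let ?Y = "(\<lambda>x. \<rho> *\<^sub>R (x + v)) ` X"
    show "finite ?Y" using X by simp
    show "card ?Y \<le> Suc (card X)"
      using card_image_le[OF X(1)] le_SucI by blast
    show "dyadic_cube \<rho> q \<subseteq> (\<Union>x\<in>?Y. cball x \<rho>)"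
    proof
      fix y assume y: "y \<in> dyadic_cube \<rho> q"
      define z where "z = (1/\<rho>) *\<^sub>R y - v"
      have yz: "y = \<rho> *\<^sub>R (z + v)"
        using \<rho> by (simp add: z_def)
      have "z \<in> cbox 0 1"
        using y \<rho> by (auto simp: mem_box_cart z_def v_def dyadic_cube_def field_simps less_imp_le)
      then obtain x where x: "x \<in> X" "dist x z < 1"
        using X(2) by auto
      have "dist (\<rho> *\<^sub>R (x + v)) y = \<rho> * dist x z"
        unfolding yz using \<rho> by (simp add: dist_norm flip: scaleR_diff_right)
      also have "\<dots> \<le> \<rho>"
        using x \<rho> by simp
      finally show "y \<in> (\<Union>x\<in>?Y. cball x \<rho>)"
        using x(1) by auto
    qed
  qed
  then show thesis
    using that[of "Suc (card X)"] by blast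
qed

lemma covering_number_Union_le:
  assumes "finite G" "\<And>p. p \<in> G \<Longrightarrow> \<exists>X. finite X \<and> card X \<le> c \<and> p \<subseteq> (\<Union>x\<in>X. cball x \<rho>)"
    and "A \<subseteq> \<Union>G"
  shows "covering_number \<rho> A \<le> c * card G"
proof -
  obtain X where X: "\<And>p. p \<in> G \<Longrightarrow> finite (X p) \<and> card (X p) \<le> c \<and> p \<subseteq> (\<Union>x\<in>X p. cball x \<rho>)"
    using assms(2) by metis
  have "covering_number \<rho> A \<le> card (\<Union>p\<in>G. X p)"
  proof (rule covering_number_le)
    show "finite (\<Union>p\<in>G. X p)" using assms(1) X by blast
    show "A \<subseteq> (\<Union>x\<in>(\<Union>p\<in>G. X p). cball x \<rho>)"
    proof
      fix y assume "y \<in> A"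
      then obtain p where p: "p \<in> G" "y \<in> p" using assms(3) by blast
      then have "y \<in> (\<Union>x\<in>X p. cball x \<rho>)" using X by blast
      then show "y \<in> (\<Union>x\<in>(\<Union>p\<in>G. X p). cball x \<rho>)" using p by blast
    qed
  qed
  also have "\<dots> \<le> (\<Sum>p\<in>G. card (X p))"
    by (rule card_UN_le[OF assms(1)])
  also have "\<dots> \<le> (\<Sum>p\<in>G. c)"
    using X by (intro sum_mono) auto
  finally show ?thesis by (simp add: mult.commute)
qed

text \<open>Each cube of \<open>G\<close> meets a ball of an optimal cover, and a ball of radius
  \<open>\<rho>\<close> meets at most \<open>3 ^ CARD('n)\<close> cubes. Together with
  \<open>covering_number_Union_le\<close>, this makes covering numbers comparable to numbers of
  cubes.\<close>

lemma card_le_covering_number: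
  fixes G :: "(real ^ 'n) set set"
  assumes "G \<subseteq> dyadic_cubes \<rho>" "bounded (\<Union>G)" "\<rho> > 0"
  shows "card G \<le> 3 ^ CARD('n) * covering_number \<rho> (\<Union>G)"
proof -
  obtain X where X: "finite X" "card X = covering_number \<rho> (\<Union>G)" "\<Union>G \<subseteq> (\<Union>x\<in>X. cball x \<rho>)"
    using covering_number_attained assms(2,3) by blast
  let ?N = "\<lambda>x. {Q \<in> dyadic_cubes \<rho>. Q \<inter> cball x \<rho> \<noteq> {}}"
  have fin: "finite (\<Union>x\<in>X. ?N x)"
    using X(1) finite_dyadic_cubes_meeting_cball[OF order_refl assms(3)] by blast
  have "G \<subseteq> (\<Union>x\<in>X. ?N x)"
  proof
    fix p assume p: "p \<in> G"
    then have p': "p \<in> dyadic_cubes \<rho>"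
      using assms(1) by blast
    then obtain y where y: "y \<in> p"
      using dyadic_cubes_nonempty assms(3) by blast
    then obtain x where "x \<in> X" "y \<in> cball x \<rho>"
      using p X(3) by blast
    then show "p \<in> (\<Union>x\<in>X. ?N x)"
      using p' y by blast
  qed
  then have "card G \<le> card (\<Union>x\<in>X. ?N x)"
    using fin by (intro card_mono)
  also have "\<dots> \<le> (\<Sum>x\<in>X. card (?N x))"
    by (rule card_UN_le[OF X(1)])
  also have "\<dots> \<le> (\<Sum>x\<in>X. 3 ^ CARD('n))"
    by (intro sum_mono card_dyadic_cubes_meeting_cball order_refl assms(3))
  finally show ?thesis
    using X(2) by (simp add: mult.commute)
qed

section \<open>From counts in dyadic cubes to non-concentration in balls\<close>

lemma dyadic_scale_above:
  fixes r :: real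
  assumes "0 < r" "r \<le> 1" "(1/2)^m \<le> r"
  obtains l where "l \<le> m" "r \<le> (1/2)^l" "(1/2)^l \<le> 2 * r"
proof -
  define l where "l = Max {l. l \<le> m \<and> r \<le> (1/2)^l}"
  have ne: "{l. l \<le> m \<and> r \<le> (1/2)^l} \<noteq> {}"
    using assms by (auto intro: exI[of _ 0])
  have l: "l \<le> m" "r \<le> (1/2)^l"
    using Max_in[OF _ ne] by (auto simp: l_def)
  have "(1/2)^l \<le> 2 * r"
  proof (cases "l = m")
    case True
    then show ?thesis using assms by simp
  next
    case False
    have "\<not> r \<le> (1/2)^Suc l"
    proof
      assume "r \<le> (1/2)^Suc l"
      with False l have "Suc l \<in> {l. l \<le> m \<and> r \<le> (1/2)^l}" by simp
      then have "Suc l \<le> l" unfolding l_def by (intro Max_ge) auto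
      then show False by simp
    qed
    then show ?thesis by simp
  qed
  with l that show thesis by blast
qed

text \<open>Replace the radius \<open>r\<close> by a dyadic side between \<open>r\<close> and
  \<open>2 * r\<close>. The ball meets boundedly many cubes of that side, \<open>count\<close>
  bounds the elements of \<open>G\<close> in each, and covering numbers are exchanged for
  cardinalities at both ends.\<close>

lemma delta_s_family_if_cube_counts:
  fixes G :: "(real ^ 'n) set set" and s :: real
  assumes c: "c > 0"
      "\<And>\<rho> (q :: int ^ 'n). \<rho> > 0 \<Longrightarrow>
         \<exists>X. finite X \<and> card X \<le> c \<and> dyadic_cube \<rho> q \<subseteq> (\<Union>x\<in>X. cball x \<rho>)"
    and G: "G \<subseteq> dyadic_cubes ((1/2)^m)" "finite G" "G \<noteq> {}"
    and s: "0 \<le> s" "s \<le> CARD('n)"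
    and count: "\<And>l Q. l \<le> m \<Longrightarrow> Q \<in> dyadic_cubes ((1/2)^l) \<Longrightarrow>
         card (cubes_within G Q) \<le> ((1/2)^l) powr s * card G"
  shows "delta_s_family ((1/2)^m) s (real c * 18 ^ CARD('n)) G"
proof -
  let ?d = "CARD('n)" and ?\<rho> = "(1/2::real)^m"
  have \<rho>: "?\<rho> > 0" by simp
  have cover: "\<exists>X. finite X \<and> card X \<le> c \<and> p \<subseteq> (\<Union>x\<in>X. cball x ?\<rho>)" if "p \<in> G" for p
    using that G(1) c(2)[OF \<rho>] by (auto simp: dyadic_cubes_def)
  have "bounded p" if p: "p \<in> G" for p
  proof -
    obtain X where X: "finite X" "p \<subseteq> (\<Union>x\<in>X. cball x ?\<rho>)"
      using cover[OF p] by blast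
    have "bounded (\<Union>x\<in>X. cball x ?\<rho>)"
      using X(1) by (intro bounded_UN) auto
    then show ?thesis using X(2) bounded_subset by blast
  qed
  then have bdd: "bounded (\<Union>G)"
    using G(2) by (intro bounded_Union) auto
  have ne: "\<Union>G \<noteq> {}"
  proof -
    obtain p where p: "p \<in> G" using G(3) by blast
    then have "p \<noteq> {}" using G(1) \<rho> dyadic_cubes_nonempty by blast
    then show ?thesis using p by blast
  qed
  have main: "real (covering_number ?\<rho> (\<Union>G \<inter> cball x r))
      \<le> (real c * 18 ^ ?d) * r powr s * real (covering_number ?\<rho> (\<Union>G))"
    if r: "?\<rho> \<le> r" "r \<le> 1" for x r
  proof -
    have r0: "r > 0" using r(1) \<rho> by linarith
    obtain l where l: "l \<le> m" "r \<le> (1/2)^l" "(1/2)^l \<le> 2 * r"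
      using dyadic_scale_above[OF r0 r(2) r(1)] by blast
    let ?N = "{Q \<in> dyadic_cubes ((1/2)^l). Q \<inter> cball x r \<noteq> {}}"
    have finN: "finite ?N"
      using finite_dyadic_cubes_meeting_cball[OF l(2)] by simp
    have fin: "finite (\<Union>Q\<in>?N. cubes_within G Q)"
      using finN G(2) by (auto simp: cubes_within_def)
    have sub: "\<Union>G \<inter> cball x r \<subseteq> \<Union>(\<Union>Q\<in>?N. cubes_within G Q)"
    proof
      fix y assume y: "y \<in> \<Union>G \<inter> cball x r"
      then obtain p where p: "p \<in> G" "y \<in> p" by blast
      then obtain k where k: "p = dyadic_cube ?\<rho> k"
        using G(1) by (auto simp: dyadic_cubes_def)
      \<comment> \<open>This is the index of the coarse cube containing \<open>y\<close>; by nesting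
        it contains all of \<open>p\<close>.\<close>
      define q where "q = (\<chi> i. \<lfloor>y $ i / (1/2)^l\<rfloor>)"
      have yq: "y \<in> dyadic_cube ((1/2)^l) q"
        by (simp add: q_def mem_dyadic_cube_iff_floor)
      then have "p \<subseteq> dyadic_cube ((1/2)^l) q"
        using dyadic_cube_subset_iff(1)[OF l(1)] p k by blast
      moreover have "dyadic_cube ((1/2)^l) q \<in> ?N"
        using yq y by (auto simp: dyadic_cubes_def)
      ultimately show "y \<in> \<Union>(\<Union>Q\<in>?N. cubes_within G Q)"
        using p unfolding cubes_within_def by blast
    qed
    have "covering_number ?\<rho> (\<Union>G \<inter> cball x r) \<le> c * card (\<Union>Q\<in>?N. cubes_within G Q)"
      by (rule covering_number_Union_le[OF fin _ sub]) (auto simp: cubes_within_def intro: cover)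
    also have "\<dots> \<le> c * (\<Sum>Q\<in>?N. card (cubes_within G Q))"
      by (intro mult_left_mono card_UN_le finN) simp
    finally have "real (covering_number ?\<rho> (\<Union>G \<inter> cball x r))
        \<le> real (c * (\<Sum>Q\<in>?N. card (cubes_within G Q)))"
      by (rule of_nat_mono)
    also have "\<dots> = c * (\<Sum>Q\<in>?N. real (card (cubes_within G Q)))"
      by (simp only: of_nat_mult of_nat_sum)
    also have "\<dots> \<le> c * (\<Sum>Q\<in>?N. ((1/2)^l) powr s * card G)"
      using l(1) by (intro mult_left_mono sum_mono count) auto
    also have "\<dots> = c * (card ?N * (((1/2)^l) powr s * card G))"
      by simp
    \<comment> \<open>The three losses are \<open>3 ^ ?d\<close> cubes meeting the ball,
      \<open>2 powr s <= 2 ^ ?d\<close> from doubling \<open>r\<close>, and \<open>3 ^ ?d\<close>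
      from bounding \<open>card G\<close> by the covering number. Their product is
      \<open>18 ^ ?d\<close>.\<close>
    also have "\<dots> \<le> c * (3 ^ ?d * ((2 ^ ?d * r powr s) * (3 ^ ?d * covering_number ?\<rho> (\<Union>G))))"
    proof (intro mult_mono mult_nonneg_nonneg)
      have "card ?N \<le> 3 ^ ?d"
        using card_dyadic_cubes_meeting_cball[OF l(2)] by simp
      from of_nat_mono[where 'a = real, OF this] show "real (card ?N) \<le> 3 ^ ?d"
        by simp
      have "((1/2)^l) powr s \<le> (2 * r) powr s"
        using l(3) s(1) by (intro powr_mono2) auto
      also have "\<dots> = 2 powr s * r powr s"
        using r0 by (simp add: powr_mult)
      also have "\<dots> \<le> 2 ^ ?d * r powr s"
        using powr_mono[OF s(2), of 2] by (intro mult_right_mono) (auto simp: powr_realpow)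
      finally show "((1/2)^l) powr s \<le> 2 ^ ?d * r powr s" .
      have "card G \<le> 3 ^ ?d * covering_number ?\<rho> (\<Union>G)"
        by (rule card_le_covering_number[OF G(1) bdd \<rho>])
      from of_nat_mono[where 'a = real, OF this] show "real (card G) \<le> 3 ^ ?d * covering_number ?\<rho> (\<Union>G)"
        by simp
    qed auto
    also have "\<dots> = (real c * 18 ^ ?d) * r powr s * real (covering_number ?\<rho> (\<Union>G))"
    proof -
      have "(18::real) ^ ?d = 3 ^ ?d * 2 ^ ?d * 3 ^ ?d"
        by (simp flip: power_mult_distrib)
      then show ?thesis by simp
    qed
    finally show ?thesis .
  qed
  show ?thesis
    unfolding delta_s_family_def delta_s_set_def
    using G(1) \<rho> s c(1) ne bdd main by (intro conjI allI impI) (simp_all add: power_le_one)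
qed

subsection \<open>Maximal cubes\<close>

text \<open>The maximum runs over infinitely many cubes. For finite \<open>P\<close> it is
  meaningful because the counts are at most \<open>card P\<close>, so they form a finite set
  (\<open>finite_counts\<close>).\<close>

definition max_count :: "(real ^ 'n) set set \<Rightarrow> nat \<Rightarrow> nat" where
  "max_count P k = Max ((\<lambda>Q. card (cubes_within P Q)) ` dyadic_cubes ((1/2)^k))"

lemma finite_counts:
  assumes "finite P"
  shows "finite ((\<lambda>Q. card (cubes_within P Q)) ` A)"
proof -
  have "(\<lambda>Q. card (cubes_within P Q)) ` A \<subseteq> {..card P}"
    using assms by (auto simp: cubes_within_def intro!: card_mono)
  then show ?thesis using finite_subset by blast
qed

lemma card_cubes_within_le_max_count:
  assumes "finite P" "Q \<in> dyadic_cubes ((1/2)^k)"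
  shows "card (cubes_within P Q) \<le> max_count P k"
  unfolding max_count_def using assms finite_counts by (intro Max_ge) auto

lemma max_count_attained:
  fixes P :: "(real ^ 'n) set set"
  assumes "finite P"
  obtains q where "card (cubes_within P (dyadic_cube ((1/2)^k) q)) = max_count P k"
proof -
  have "max_count P k \<in> (\<lambda>Q. card (cubes_within P Q)) ` dyadic_cubes ((1/2)^k)"
    unfolding max_count_def using assms finite_counts
    by (intro Max_in) (auto simp: dyadic_cubes_def)
  then show thesis
    using that by (auto simp: dyadic_cubes_def)
qed

lemma max_count_0:
  assumes "finite P" "P \<subseteq> dyadic_cubes_in_unit \<delta>"
  shows "max_count P 0 = card P"
proof (rule antisym)
  obtain q where "card (cubes_within P (dyadic_cube ((1/2)^0) q)) = max_count P 0"
    using max_count_attained[OF assms(1)] by blast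
  then show "max_count P 0 \<le> card P"
    using assms(1) card_mono[of P "cubes_within P (dyadic_cube ((1/2)^0) q)"]
    by (auto simp: cubes_within_def)
  have unit: "dyadic_cube ((1/2)^0) 0 = unit_cube"
    by (auto simp: dyadic_cube_def unit_cube_def)
  have "cubes_within P unit_cube = P"
    using assms(2) by (auto simp: cubes_within_def dyadic_cubes_in_unit_def)
  then show "card P \<le> max_count P 0"
    using card_cubes_within_le_max_count[OF assms(1), of unit_cube 0] unit
    by (metis dyadic_cubes_def rangeI)
qed

lemma max_count_pos:
  assumes "finite P" "P \<subseteq> dyadic_cubes ((1/2)^n)" "P \<noteq> {}" "k \<le> n"
  shows "max_count P k > 0"
proof -
  obtain p where p: "dyadic_cube ((1/2)^n) p \<in> P"
    using assms(2,3) by (auto simp: dyadic_cubes_def)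
  obtain x where x: "x \<in> dyadic_cube ((1/2)^n) p"
    using dyadic_cube_nonempty[of "(1/2)^n" p] by auto
  define q where "q = (\<chi> i. p $ i div 2 ^ (n - k))"
  have "dyadic_cube ((1/2)^n) p \<subseteq> dyadic_cube ((1/2)^k) q"
    using dyadic_cube_subset_iff[OF assms(4) x, of q] by (simp add: q_def)
  then have "dyadic_cube ((1/2)^n) p \<in> cubes_within P (dyadic_cube ((1/2)^k) q)"
    using p by (simp add: cubes_within_def)
  then have "0 < card (cubes_within P (dyadic_cube ((1/2)^k) q))"
    using assms(1) by (auto simp: card_gt_0_iff cubes_within_def)
  also have "\<dots> \<le> max_count P k"
    by (rule card_cubes_within_le_max_count[OF assms(1)]) (simp add: dyadic_cubes_def)
  finally show ?thesis .
qed

lemma max_count_le: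
  fixes P :: "(real ^ 'n) set set"
  assumes "finite P" "P \<subseteq> dyadic_cubes ((1/2)^n)" "k \<le> n"
  shows "max_count P k \<le> (2 ^ (n - k)) ^ CARD('n)"
proof -
  obtain q where q: "card (cubes_within P (dyadic_cube ((1/2)^k) q)) = max_count P k"
    using max_count_attained[OF assms(1)] by blast
  show ?thesis
    using card_cubes_within_le[OF assms(2) _ assms(3), of "dyadic_cube ((1/2)^k) q"]
    by (simp add: q dyadic_cubes_def)
qed

text \<open>Pulling \<open>Q\<close> back by the rescaling gives a dyadic cube of side
  \<open>(1/2)^(k + l)\<close>. Hence concentration of the rescaled family at level \<open>l\<close>
  is controlled by that of \<open>P\<close> at level \<open>k + l\<close>.\<close>

lemma card_cubes_within_rescale_le:
  assumes "finite P" "Q \<in> dyadic_cubes ((1/2)^l)"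
  shows "card (cubes_within ((`) (rescale (dyadic_cube ((1/2)^k) q)) ` P) Q) \<le> max_count P (k + l)"
proof -
  let ?S = "rescale (dyadic_cube ((1/2)^k) q)"
  obtain j where j: "Q = dyadic_cube ((1/2)^l) j"
    using assms(2) by (auto simp: dyadic_cubes_def)
  define Q' where "Q' = dyadic_cube ((1/2)^(k + l)) (\<chi> i. j $ i + 2^l * q $ i)"
  have img: "?S ` Q' = Q"
    using rescale_image_dyadic_cube[of "(1/2)^k" q l "\<chi> i. j $ i + 2^l * q $ i"]
    by (simp add: Q'_def j power_add)
  have inj: "inj ?S"
    by (rule inj_rescale_dyadic_cube) simp
  have "cubes_within ((`) ?S ` P) Q \<subseteq> (`) ?S ` cubes_within P Q'"
    using inj by (auto simp: cubes_within_def inj_image_subset_iff simp flip: img)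
  then have "card (cubes_within ((`) ?S ` P) Q) \<le> card (cubes_within P Q')"
    using assms(1) by (intro surj_card_le) (auto simp: cubes_within_def)
  also have "\<dots> \<le> max_count P (k + l)"
    using assms(1) by (rule card_cubes_within_le_max_count) (simp add: Q'_def dyadic_cubes_def)
  finally show ?thesis .
qed

lemma rescale_image_in_dyadic_cubes:
  assumes "p \<in> dyadic_cubes ((1/2)^n)" "k \<le> n"
  shows "rescale (dyadic_cube ((1/2)^k) q) ` p \<in> dyadic_cubes ((1/2)^(n - k))"
proof -
  have *: "(1/2::real)^n = (1/2)^k * (1/2)^(n - k)"
    using assms(2) by (simp flip: power_add)
  obtain j where j: "p = dyadic_cube ((1/2)^k * (1/2)^(n - k)) j"
    using assms(1) unfolding dyadic_cubes_def * by (elim rangeE)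
  show ?thesis
    unfolding j by (subst rescale_image_dyadic_cube) (simp_all add: dyadic_cubes_def)
qed

section \<open>Choice of the cube and conclusion\<close>

text \<open>Apply \<open>exists_supporting_index\<close> to the logarithmic decay \<open>a\<close>
  of the maximal counts, and take a cube realising the maximum at level \<open>k\<close> with all of
  \<open>P\<close> inside it. The linear lower bound on \<open>a\<close> gives non-concentration,
  and \<open>a k <= n * s / C\<close> gives the size bound.\<close>

lemma exists_good_cube:
  fixes P :: "(real ^ 'd) set set"
  assumes c: "c > 0"
      "\<And>\<rho> (q :: int ^ 'd). \<rho> > 0 \<Longrightarrow>
         \<exists>X. finite X \<and> card X \<le> c \<and> dyadic_cube \<rho> q \<subseteq> (\<Union>x\<in>X. cball x \<rho>)"
    and C: "C > 0" and s0: "s0 > 0" "s0 * exp C < C * t" and n: "n > 0"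
    and P: "P \<subseteq> dyadic_cubes_in_unit ((1/2)^n)" and card_P: "real (card P) = ((1/2)^n) powr (- t)"
  shows "\<exists>k\<le>n. \<exists>s::real. s \<ge> s0 \<and> s \<le> CARD('d) \<and> (\<exists>Q \<in> dyadic_cubes_meeting ((1/2)^k) P.
      real (card (cubes_within P Q)) \<ge> ((1/2)^n) powr (s / C) * real (card P) \<and>
      delta_s_family ((1/2)^(n - k)) s (real c * 18 ^ CARD('d)) ((`) (rescale Q) ` cubes_within P Q))"
proof -
  have half_powr: "((1/2)^m) powr u = 2 powr (- (m * u))" for m :: nat and u :: real
  proof -
    have "(1/2)^m = 2 powr (- real m)"
      by (simp add: powr_minus powr_realpow power_one_over inverse_eq_divide)
    then show ?thesis
      by (simp add: powr_powr)
  qed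
  \<comment> \<open>Positivity yields finiteness as well, since \<open>card\<close> is 0 on infinite
    sets.\<close>
  have "real (card P) > 0"
    unfolding card_P by simp
  then have fin: "finite P" and ne: "P \<noteq> {}"
    by (auto simp: card_gt_0_iff)
  have Pn: "P \<subseteq> dyadic_cubes ((1/2)^n)"
    using P by (auto simp: dyadic_cubes_in_unit_def)
  define M where "M k = real (max_count P k)" for k
  have M_pos: "M k > 0" if "k \<le> n" for k
    using max_count_pos[OF fin Pn ne that] by (simp add: M_def)
  have M_0: "M 0 = 2 powr (n * t)"
    using max_count_0[OF fin P] card_P by (simp add: M_def half_powr)
  have M_le: "M k \<le> 2 powr (real CARD('d) * (real n - real k))" if "k \<le> n" for k
  proof -
    have "M k \<le> real ((2 ^ (n - k)) ^ CARD('d))"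
      unfolding M_def using max_count_le[OF fin Pn that] of_nat_le_iff by blast
    also have "\<dots> = 2 powr real ((n - k) * CARD('d))"
      by (subst powr_realpow) (simp_all add: power_mult)
    finally show ?thesis
      using that by (simp add: of_nat_diff mult.commute)
  qed
  define a where "a k = n * t - log 2 (M k)" for k
  have M_eq: "M k = 2 powr (n * t - a k)" if "k \<le> n" for k
    using M_pos[OF that] by (simp add: a_def)
  have a_0: "a 0 = 0"
    by (simp add: a_def M_0)
  \<comment> \<open>At level \<open>n\<close> the bound \<open>M_le\<close> reads
    \<open>M n <= 1\<close>: a cube of the finest side contains at most one element of
    \<open>P\<close>.\<close>
  have a_n: "a n \<ge> t * n"
    using M_le[of n] M_pos[of n] by (simp add: a_def mult.commute)
  obtain k and s :: real where k: "k < n" and s: "s \<ge> s0" "a k \<le> n * s / C"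
    and *: "\<forall>j. k \<le> j \<and> j \<le> n \<longrightarrow> a j \<ge> a k + s * (real j - real k)"
    using exists_supporting_index[OF n C s0 a_0 a_n] by auto
  have grow: "a j \<ge> a k + s * (real j - real k)" if "k \<le> j" "j \<le> n" for j
    using * that by blast
  \<comment> \<open>From level \<open>k\<close> to level \<open>n\<close>, \<open>a\<close> rises by
    at least \<open>s * (n - k)\<close>, while \<open>M_le\<close> at \<open>k\<close> and
    \<open>a n <= n * t\<close> allow a rise of at most \<open>CARD('d) * (n - k)\<close>.
    Cancelling the factor uses the strict inequality \<open>k < n\<close>.\<close>
  have s_le: "s \<le> CARD('d)"
  proof -
    have "2 powr (n * t - a k) \<le> 2 powr (real CARD('d) * (real n - real k))"
      using M_le[of k] M_eq[of k] k by simp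
    then have "n * t - a k \<le> real CARD('d) * (real n - real k)"
      by simp
    moreover have "a n \<ge> a k + s * (real n - real k)"
      using grow[of n] k by simp
    moreover have "a n \<le> n * t"
      using max_count_pos[OF fin Pn ne, of n] by (simp add: a_def M_def)
    ultimately have "s * (real n - real k) \<le> real CARD('d) * (real n - real k)"
      by linarith
    then show ?thesis
      using k by simp
  qed
  obtain q where q: "card (cubes_within P (dyadic_cube ((1/2)^k) q)) = max_count P k"
    using max_count_attained[OF fin] by blast
  define Q where "Q = dyadic_cube ((1/2)^k) q"
  let ?R = "cubes_within P Q" and ?G = "(`) (rescale Q) ` cubes_within P Q"
  have card_R: "real (card ?R) = M k"
    using q by (simp add: Q_def M_def)
  have "card ?R > 0"
    using card_R M_pos[of k] k by simp
  then have R: "?R \<subseteq> P" "?R \<noteq> {}"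
    by (simp add: cubes_within_def) (metis \<open>card ?R > 0\<close> card.empty less_numeral_extra(3))
  then have finR: "finite ?R"
    using fin finite_subset by blast
  have inj: "inj (rescale Q)"
    unfolding Q_def by (rule inj_rescale_dyadic_cube) simp
  then have card_G: "card ?G = card ?R"
    by (intro card_image) (meson inj_image_eq_iff inj_onI)
  have "Q \<inter> \<Union>P \<noteq> {}"
  proof -
    obtain p where p: "p \<in> P" "p \<subseteq> Q"
      using R(2) by (auto simp: cubes_within_def)
    then have "p \<in> dyadic_cubes ((1/2)^n)"
      using Pn by blast
    then have "p \<noteq> {}"
      by (rule dyadic_cubes_nonempty) simp
    with p show ?thesis by blast
  qed
  then have meet: "Q \<in> dyadic_cubes_meeting ((1/2)^k) P"
    by (simp add: dyadic_cubes_meeting_def Q_def dyadic_cubes_def)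
  have large: "real (card ?R) \<ge> ((1/2)^n) powr (s / C) * real (card P)"
  proof -
    have "((1/2)^n) powr (s / C) * real (card P) = 2 powr (n * t - n * s / C)"
      by (simp add: card_P half_powr flip: powr_add)
    also have "\<dots> \<le> 2 powr (n * t - a k)"
      using s(2) by simp
    finally show ?thesis
      using card_R M_eq[of k] k by simp
  qed
  have "delta_s_family ((1/2)^(n - k)) s (real c * 18 ^ CARD('d)) ?G"
  proof (rule delta_s_family_if_cube_counts)
    show "c > 0" by (rule c(1))
    show "\<exists>X. finite X \<and> card X \<le> c \<and> dyadic_cube \<rho> q \<subseteq> (\<Union>x\<in>X. cball x \<rho>)"
      if "\<rho> > 0" for \<rho> and q :: "int ^ 'd"
      using c(2)[OF that] .
    show "?G \<subseteq> dyadic_cubes ((1/2)^(n - k))"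
      using Pn R(1) k unfolding Q_def
      by (auto intro!: rescale_image_in_dyadic_cubes)
    show "finite ?G" "?G \<noteq> {}" using finR R(2) by auto
    show "0 \<le> s" "s \<le> CARD('d)" using s s0 s_le by auto
    fix l and Q' :: "(real ^ 'd) set"
    assume l: "l \<le> n - k" and Q': "Q' \<in> dyadic_cubes ((1/2)^l)"
    \<comment> \<open>Passing from \<open>?R\<close> to all of \<open>P\<close> only enlarges the
      count and makes \<open>max_count\<close> applicable. Then \<open>grow\<close> at
      \<open>k + l\<close> produces the factor \<open>2 powr (- (l * s))\<close> relative to
      \<open>M k = card ?G\<close>.\<close>
    have "card (cubes_within ?G Q') \<le> card (cubes_within ((`) (rescale Q) ` P) Q')"
      using fin R(1) by (intro card_mono) (auto simp: cubes_within_def)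
    also have "\<dots> \<le> max_count P (k + l)"
      unfolding Q_def by (rule card_cubes_within_rescale_le[OF fin Q'])
    finally have "real (card (cubes_within ?G Q')) \<le> M (k + l)"
      by (simp add: M_def)
    also have "\<dots> = 2 powr (n * t - a (k + l))"
      using l k by (intro M_eq) simp
    also have "\<dots> \<le> 2 powr (n * t - (a k + s * l))"
    proof -
      have "k + l \<le> n" using l k by simp
      then show ?thesis using grow[of "k + l"] by simp
    qed
    also have "\<dots> = 2 powr (- (l * s)) * 2 powr (n * t - a k)"
      by (simp add: algebra_simps flip: powr_add)
    also have "\<dots> = ((1/2)^l) powr s * card ?G"
      using card_R M_eq[of k] k by (simp add: half_powr card_G)
    finally show "real (card (cubes_within ?G Q')) \<le> ((1/2)^l) powr s * card ?G" .
  qed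
  with meet large s s_le k show ?thesis
    by (intro exI[of _ k] exI[of _ s] conjI bexI[of _ Q]) auto
qed

theorem proposition2p26:
  fixes C t :: real
  assumes "C \<ge> 1" and "t > 0"
  shows "\<exists>\<eta>\<^sub>0 \<delta>\<^sub>0 K :: real.
    0 < \<eta>\<^sub>0 \<and> \<eta>\<^sub>0 < real CARD('d::finite) / C \<and> 0 < \<delta>\<^sub>0 \<and> 1 \<le> K \<and>
    (\<forall>\<delta> \<in> dyadic_scales. \<delta> \<le> \<delta>\<^sub>0 \<longrightarrow>
      (\<forall>P :: (real ^ 'd) set set.
        P \<subseteq> dyadic_cubes_in_unit \<delta> \<and> real (card P) = \<delta> powr (- t) \<longrightarrow>
        (\<exists>\<Delta> \<in> dyadic_scales. \<delta> \<le> \<Delta> \<and> \<Delta> \<le> 1 \<and>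
          (\<exists>\<eta>. \<eta>\<^sub>0 \<le> \<eta> \<and> \<eta> \<le> real CARD('d) / C \<and>
            (\<exists>Q \<in> dyadic_cubes_meeting \<Delta> P. \<exists>P\<^sub>Q. P\<^sub>Q \<subseteq> cubes_within P Q \<and>
              real (card P\<^sub>Q) \<ge> \<delta> powr \<eta> * real (card P) \<and>
              delta_s_family (\<delta> / \<Delta>) (C * \<eta>) K ((`) (rescale Q) ` P\<^sub>Q))))))"
proof -
  obtain c :: nat where c: "c > 0"
      "\<And>\<rho> (q :: int ^ 'd). \<rho> > 0 \<Longrightarrow>
         \<exists>X. finite X \<and> card X \<le> c \<and> dyadic_cube \<rho> q \<subseteq> (\<Union>x\<in>X. cball x \<rho>)"
    using dyadic_cube_cover by blast
  have C: "C > 0" using assms(1) by simp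
  \<comment> \<open>The first term keeps \<open>s0 / C\<close> strictly below
    \<open>CARD('d) / C\<close>; the second gives \<open>s0 * exp C < C * t\<close>. The halves make
    both inequalities strict.\<close>
  define s0 where "s0 = min (real CARD('d) / 2) (C * t * exp (- C) / 2)"
  have s0: "s0 > 0" "s0 < CARD('d)"
    using C assms(2) by (auto simp: s0_def min_def)
  have "s0 \<le> C * t * exp (- C) / 2"
    by (simp add: s0_def)
  then have "s0 * exp C \<le> C * t * exp (- C) / 2 * exp C"
    by (intro mult_right_mono) auto
  also have "\<dots> < C * t"
    using C assms(2) by (simp add: exp_minus)
  finally have s0C: "s0 * exp C < C * t" .
  show ?thesis
  \<comment> \<open>The threshold \<open>1/2\<close> for \<open>\<delta>\<close> serves to exclude
    \<open>n = 0\<close>. The exponent will be \<open>\<eta> = s / C\<close>, so that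
    \<open>C * \<eta>\<close> is the dimension \<open>s\<close> and \<open>s >= s0\<close> becomes
    the lower bound on \<open>\<eta>\<close>.\<close>
  proof (rule exI[of _ "s0 / C"], rule exI[of _ "1/2"], rule exI[of _ "real c * 18 ^ CARD('d)"],
      intro conjI ballI impI allI)
    show "(0::real) < 1/2" by simp
    show "0 < s0 / C" "s0 / C < real CARD('d) / C"
      using s0 C by (auto simp: divide_strict_right_mono)
    have "1 * 1 \<le> real c * 18 ^ CARD('d)" using c(1) by (intro mult_mono) auto
    then show "1 \<le> real c * 18 ^ CARD('d)" by simp
  next
    fix \<delta> :: real and P :: "(real ^ 'd) set set"
    assume \<delta>: "\<delta> \<in> dyadic_scales" "\<delta> \<le> 1/2"
      and "P \<subseteq> dyadic_cubes_in_unit \<delta> \<and> real (card P) = \<delta> powr (- t)"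
    then have P: "P \<subseteq> dyadic_cubes_in_unit \<delta>" "real (card P) = \<delta> powr (- t)"
      by auto
    obtain n where n: "\<delta> = (1/2)^n" using \<delta>(1) by (auto simp: dyadic_scales_def)
    have "n > 0" using \<delta>(2) n by (cases n) auto
    then obtain k and s :: real and Q where k: "k \<le> n" and s: "s0 \<le> s" "s \<le> CARD('d)"
      and Q: "Q \<in> dyadic_cubes_meeting ((1/2)^k) P"
        "real (card (cubes_within P Q)) \<ge> ((1/2)^n) powr (s / C) * real (card P)"
        "delta_s_family ((1/2)^(n - k)) s (real c * 18 ^ CARD('d)) ((`) (rescale Q) ` cubes_within P Q)"
      using exists_good_cube[OF c C s0(1) s0C _ P[unfolded n]] by blast
    have "\<delta> / (1/2)^k = (1/2)^(n - k)"
      using k by (simp add: n power_diff)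
    then show "\<exists>\<Delta> \<in> dyadic_scales. \<delta> \<le> \<Delta> \<and> \<Delta> \<le> 1 \<and>
          (\<exists>\<eta>. s0 / C \<le> \<eta> \<and> \<eta> \<le> real CARD('d) / C \<and>
            (\<exists>Q \<in> dyadic_cubes_meeting \<Delta> P. \<exists>P\<^sub>Q. P\<^sub>Q \<subseteq> cubes_within P Q \<and>
              real (card P\<^sub>Q) \<ge> \<delta> powr \<eta> * real (card P) \<and>
              delta_s_family (\<delta> / \<Delta>) (C * \<eta>) (real c * 18 ^ CARD('d))
                ((`) (rescale Q) ` P\<^sub>Q)))"
      using k s Q C
      by (intro bexI[of _ "(1/2)^k"] conjI exI[of _ "s / C"] bexI[of _ Q]
          exI[of _ "cubes_within P Q"])
        (auto simp: n dyadic_scales_def divide_right_mono power_decreasing power_le_one)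
  qed
qed

end
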